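(* Let $N,m,n\ge1$, let $F(\bm{X})=-\ln\det\bm{X}$ on $\mathscr{P}(N,\mathbb{C})$ (the function corresponding to the total log-determinant divergence), and let $\bm{X}_1,\dots,\bm{X}_m$ (data) and $\bm{P}_1,\dots,\bm{P}_n$ (outliers) be matrices in $\mathscr{P}(N,\mathbb{C})$. Let $\overline{\bm{X}}$ be the TLD mean of $\bm{X}_1,\dots,\bm{X}_m$ and, for small $\varepsilon>0$, let $\widehat{\bm{X}}$ be the TLD mean of the data contaminated by the outliers with weight $\varepsilon$, and write $\widehat{\bm{X}}=\overline{\bm{X}}+\varepsilon\bm{H}+O(\varepsilon^2)$. Then $\nabla F(\bm{X})=-\bm{X}^{-1}$, $\frac{d}{d\varepsilon}\big|_{\varepsilon=0}\nabla F(\widehat{\bm{X}})=\overline{\bm{X}}^{-1}\bm{H}\overline{\bm{X}}^{-1}$, and the influence function of the TLD mean is $h=\|\bm{H}\|$ with $$\bm{H}=\frac mn\left(\sum_{i=1}^m\frac1{\sqrt{1+\|\bm{X}_i^{-1}\|^2}}\right)^{-1}\sum_{j=1}^n\frac{\overline{\bm{X}}\left(\overline{\bm{X}}^{-1}-\bm{P}_j^{-1}\right)\overline{\bm{X}}}{\sqrt{1+\|\bm{P}_j^{-1}\|^2}}.$$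
   Context: $\mathscr{P}(N,\mathbb{C})$ is the set of $N\times N$ complex Hermitian positive-definite matrices; $\langle\bm{X},\bm{Y}\rangle=\operatorname{tr}(\bm{X}^{\mathrm H}\bm{Y})$ and $\|\bm{X}\|=\sqrt{\langle\bm{X},\bm{X}\rangle}$. The gradient $\nabla F(\bm{X})$ is the Hermitian matrix with $\langle\nabla F(\bm{X}),\bm{V}\rangle=\frac{d}{dt}\big|_{t=0}F(\bm{X}+t\bm{V})$ for all Hermitian $\bm{V}$. The total Bregman divergence is $\delta_F(\bm{X},\bm{Y})=\frac{F(\bm{X})-F(\bm{Y})-\langle \nabla F(\bm{Y}),\bm{X}-\bm{Y}\rangle}{\sqrt{1+\|\nabla F(\bm{Y})\|^2}}$; for the present $F$ it is called the total log-determinant (TLD) divergence. The mean $\overline{\bm{X}}$ is the minimizer over $\mathscr{P}(N,\mathbb{C})$ of $\frac1m\sum_{i=1}^m\delta_F(\bm{X},\bm{X}_i)$. The contaminated mean $\widehat{\bm{X}}=\widehat{\bm{X}}(\varepsilon)$ is the minimizer over $\mathscr{P}(N,\mathbb{C})$ of $$(1-\varepsilon)\frac1m\sum_{i=1}^m\delta_F(\bm{X},\bm{X}_i)+\varepsilon\frac1n\sum_{j=1}^n\delta_F(\bm{X},\bm{P}_j).$$ The matrix $\bm{H}=\bm{H}(\overline{\bm{X}},\bm{P}_1,\dots,\bm{P}_n)$ is the first-order coefficient in $\widehat{\bm{X}}=\overline{\bm{X}}+\varepsilon\bm{H}+O(\varepsilon^2)$ as $\varepsilon\to0$, and the influence function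 is $h=\|\bm{H}\|$. *)

theory Defs
  imports "HOL-Analysis.Analysis" "HOL-Library.Landau_Symbols"
begin

type_synonym 'N cmat = "complex ^ 'N ^ 'N"

definition ctranspose :: "'N::finite cmat \<Rightarrow> 'N cmat" where
  "ctranspose A = (\<chi> i j. cnj (A $ j $ i))"

definition hermitian :: "'N::finite cmat \<Rightarrow> bool" where
  "hermitian A \<longleftrightarrow> ctranspose A = A"

text \<open>The quadratic form of a Hermitian matrix is real-valued, so taking \<open>Re\<close> loses nothing.\<close>

definition hpd :: "'N::finite cmat set" where
  "hpd = {A. hermitian A \<and>
             (\<forall>x. x \<noteq> 0 \<longrightarrow> 0 < Re (\<Sum>i\<in>UNIV. cnj (x $ i) * (A *v x) $ i))}"

definition trace_inner :: "'N::finite cmat \<Rightarrow> 'N cmat \<Rightarrow> complex" where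
  "trace_inner A B = trace (ctranspose A ** B)"

definition frob_norm :: "'N::finite cmat \<Rightarrow> real" where
  "frob_norm A = sqrt (Re (trace_inner A A))"

text \<open>These agree with the library's real inner product and norm on \<open>complex ^ 'N ^ 'N\<close>.\<close>

lemma Re_trace_inner: "Re (trace_inner A B) = inner A B"
proof -
  have "Re (trace_inner A B) = (\<Sum>i\<in>UNIV. \<Sum>k\<in>UNIV. inner (A $ k $ i) (B $ k $ i))"
    by (simp add: trace_inner_def trace_def ctranspose_def matrix_matrix_mult_def inner_complex_def)
  also have "\<dots> = inner A B"
    by (simp add: inner_vec_def) (rule sum.swap)
  finally show ?thesis .
qed

lemma frob_norm_eq_norm: "frob_norm A = norm A"
  by (simp add: frob_norm_def Re_trace_inner norm_eq_sqrt_inner)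

definition has_gradient :: "('N::finite cmat \<Rightarrow> real) \<Rightarrow> 'N cmat \<Rightarrow> 'N cmat \<Rightarrow> bool" where
  "has_gradient F X G \<longleftrightarrow> hermitian G \<and>
     (\<forall>V. hermitian V \<longrightarrow>
        ((\<lambda>t::real. complex_of_real (F (X + t *\<^sub>R V)))
           has_vector_derivative trace_inner G V) (at 0))"

definition gradient :: "('N::finite cmat \<Rightarrow> real) \<Rightarrow> 'N cmat \<Rightarrow> 'N cmat" where
  "gradient F X = (THE G. has_gradient F X G)"

text \<open>Total Bregman divergence. The inner product is real because it is only applied to
  Hermitian matrices.\<close>

definition total_bregman :: "('N::finite cmat \<Rightarrow> real) \<Rightarrow> 'N cmat \<Rightarrow> 'N cmat \<Rightarrow> real" where
  "total_bregman F X Y =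
     (F X - F Y - Re (trace_inner (gradient F Y) (X - Y)))
       / sqrt (1 + (frob_norm (gradient F Y))\<^sup>2)"

definition is_tbd_mean ::
  "('N::finite cmat \<Rightarrow> real) \<Rightarrow> nat \<Rightarrow> (nat \<Rightarrow> 'N cmat) \<Rightarrow> 'N cmat \<Rightarrow> bool" where
  "is_tbd_mean F m X M \<longleftrightarrow>
     is_arg_min (\<lambda>Y. (1 / real m) * (\<Sum>i=1..m. total_bregman F Y (X i))) (\<lambda>Y. Y \<in> hpd) M"

definition is_contaminated_tbd_mean ::
  "('N::finite cmat \<Rightarrow> real) \<Rightarrow> nat \<Rightarrow> (nat \<Rightarrow> 'N cmat) \<Rightarrow> nat \<Rightarrow> (nat \<Rightarrow> 'N cmat) \<Rightarrow> real
     \<Rightarrow> 'N cmat \<Rightarrow> bool" where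
  "is_contaminated_tbd_mean F m X n P \<epsilon> M \<longleftrightarrow>
     is_arg_min
       (\<lambda>Y. (1 - \<epsilon>) * ((1 / real m) * (\<Sum>i=1..m. total_bregman F Y (X i)))
            + \<epsilon> * ((1 / real n) * (\<Sum>j=1..n. total_bregman F Y (P j))))
       (\<lambda>Y. Y \<in> hpd) M"

text \<open>\<open>Xhat \<epsilon> = Xbar + \<epsilon> H + O(\<epsilon>\<^sup>2)\<close>; contamination weights are nonnegative,
  hence the one-sided filter.\<close>

definition is_first_order_coeff ::
  "(real \<Rightarrow> 'N::finite cmat) \<Rightarrow> 'N cmat \<Rightarrow> 'N cmat \<Rightarrow> bool" where
  "is_first_order_coeff Xhat Xbar H \<longleftrightarrow>
     (\<lambda>\<epsilon>. frob_norm (Xhat \<epsilon> - (Xbar + \<epsilon> *\<^sub>R H))) \<in> O[at_right 0](\<lambda>\<epsilon>. \<epsilon>\<^sup>2)"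

definition influence_matrix :: "(real \<Rightarrow> 'N::finite cmat) \<Rightarrow> 'N cmat \<Rightarrow> 'N cmat" where
  "influence_matrix Xhat Xbar = (THE H. is_first_order_coeff Xhat Xbar H)"

definition influence_function :: "(real \<Rightarrow> 'N::finite cmat) \<Rightarrow> 'N cmat \<Rightarrow> real" where
  "influence_function Xhat Xbar = frob_norm (influence_matrix Xhat Xbar)"

text \<open>The determinant of a Hermitian positive-definite matrix is a positive real.\<close>

definition neg_log_det :: "'N::finite cmat \<Rightarrow> real" where
  "neg_log_det X = - ln (Re (det X))"

end

theory Submission
  imports Defs
begin

text \<open>At a minimizer \<open>M\<close> of the contaminated objective the derivative vanishes in every
  Hermitian direction. As \<open>\<nabla>F(M) = -M\<^sup>-\<^sup>1\<close>, this is an affine equation in \<open>M\<^sup>-\<^sup>1\<close>, with solution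
  \<open>Xhat \<epsilon>\<^sup>-\<^sup>1 = Xbar\<^sup>-\<^sup>1 + c(\<epsilon>) D\<close> where \<open>c(\<epsilon>) = \<epsilon> / ((1 - \<epsilon>) a + \<epsilon> b)\<close>, \<open>a\<close> and \<open>b\<close> are the mean
  weights of the data and of the outliers, and \<open>D\<close> does not depend on \<open>\<epsilon>\<close>. Inverting this path
  and using \<open>c(\<epsilon>) = \<epsilon> / a + O(\<epsilon>\<^sup>2)\<close> gives the expansion with \<open>H = - Xbar D Xbar / a\<close>.\<close>

section \<open>Matrix products and inverses\<close>

text \<open>In finite dimension bilinearity already gives boundedness. The interpretation below then
  supplies distributivity and the norm estimate for products.\<close>

lemma bounded_bilinear_matrix_mult:
  "bounded_bilinear ((**) :: complex^'m::finite^'n::finite \<Rightarrow> complex^'p::finite^'m \<Rightarrow> complex^'p^'n)"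
  unfolding bilinear_conv_bounded_bilinear[symmetric] bilinear_def
  by (auto intro!: linearI simp: vec_eq_iff matrix_matrix_mult_def algebra_simps
      sum.distrib scaleR_sum_right)

interpretation matrix_mult: bounded_bilinear
  "(**) :: complex^'m::finite^'n::finite \<Rightarrow> complex^'p::finite^'m \<Rightarrow> complex^'p^'n"
  by (rule bounded_bilinear_matrix_mult)

lemma matrix_vector_mult_scaleR_complex:
  fixes A :: "complex^'n::finite^'m::finite"
  shows "(t *\<^sub>R A) *v x = t *\<^sub>R (A *v x)" "A *v (t *\<^sub>R x) = t *\<^sub>R (A *v x)"
  by (simp_all add: vec_eq_iff matrix_vector_mult_def scaleR_sum_right)

lemma matrix_inv_mult:
  fixes A :: "'a::field^'n::finite^'n"
  assumes "invertible A"
  shows "A ** matrix_inv A = mat 1" "matrix_inv A ** A = mat 1"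
proof -
  have "A ** matrix_inv A = mat 1 \<and> matrix_inv A ** A = mat 1"
    using assms unfolding invertible_def matrix_inv_def by (rule someI_ex)
  then show "A ** matrix_inv A = mat 1" "matrix_inv A ** A = mat 1" by auto
qed

lemma matrix_inv_unique:
  fixes A :: "'a::field^'n::finite^'n"
  assumes "A ** B = mat 1"
  shows "matrix_inv A = B"
proof -
  have "invertible A"
    using assms matrix_left_right_inverse invertible_def by blast
  then show ?thesis
    using assms by (metis matrix_inv_mult(2) matrix_mul_assoc matrix_mul_lid matrix_mul_rid)
qed

section \<open>Conjugate transposes and Hermitian matrices\<close>

lemma ctranspose_add: "ctranspose (A + B) = ctranspose A + ctranspose B"
  and ctranspose_diff: "ctranspose (A - B) = ctranspose A - ctranspose B"
  and ctranspose_minus: "ctranspose (- A) = - ctranspose A"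
  and ctranspose_scaleR: "ctranspose (r *\<^sub>R A) = r *\<^sub>R ctranspose A"
  and ctranspose_mat_1: "ctranspose (mat 1) = mat 1"
  and ctranspose_mult: "ctranspose (A ** B) = ctranspose B ** ctranspose A"
  by (auto simp: ctranspose_def vec_eq_iff mat_def matrix_matrix_mult_def mult.commute)

lemma hermitian_add: "hermitian A \<Longrightarrow> hermitian B \<Longrightarrow> hermitian (A + B)"
  and hermitian_diff: "hermitian A \<Longrightarrow> hermitian B \<Longrightarrow> hermitian (A - B)"
  and hermitian_minus: "hermitian A \<Longrightarrow> hermitian (- A)"
  and hermitian_scaleR: "hermitian A \<Longrightarrow> hermitian (r *\<^sub>R A)"
  and hermitian_mat_1: "hermitian (mat 1)"
  by (simp_all add: hermitian_def ctranspose_add ctranspose_diff ctranspose_minus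
      ctranspose_scaleR ctranspose_mat_1)

lemma hermitian_sum: "(\<And>i. i \<in> I \<Longrightarrow> hermitian (A i)) \<Longrightarrow> hermitian (sum A I)"
proof (induction I rule: infinite_finite_induct)
  case (insert i I)
  then show ?case by (simp add: hermitian_add)
qed (simp_all add: hermitian_def ctranspose_def vec_eq_iff)

text \<open>The conjugate transpose of the inverse is again an inverse of \<open>A\<close>, and
  inverses are unique.\<close>

lemma hermitian_matrix_inv:
  assumes "hermitian A" "invertible A"
  shows "hermitian (matrix_inv A)"
proof -
  have "A ** ctranspose (matrix_inv A) = ctranspose (matrix_inv A ** A)"
    using assms(1) by (simp add: ctranspose_mult hermitian_def)
  also have "\<dots> = mat 1"
    using assms(2) by (simp add: matrix_inv_mult ctranspose_mat_1)
  finally show ?thesis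
    using matrix_inv_unique hermitian_def by metis
qed

lemma cnj_trace: "cnj (trace A) = trace (ctranspose A)"
  by (simp add: trace_def ctranspose_def)

lemma cnj_det: "cnj (det A) = det (ctranspose A)"
proof -
  have "cnj (det A) = det (transpose (ctranspose A))"
    by (simp add: det_def transpose_def ctranspose_def)
  then show ?thesis by simp
qed

text \<open>Conjugation reverses the order of the two factors under the trace, and cyclicity
  restores it. This links the complex pairing in \<open>has_gradient\<close> to the real inner
  product.\<close>

lemma trace_inner_hermitian_real:
  assumes "hermitian A" "hermitian B"
  shows "trace_inner A B = of_real (A \<bullet> B)"
proof -
  have "cnj (trace_inner A B) = trace_inner A B"
    using assms by (simp add: trace_inner_def cnj_trace ctranspose_mult hermitian_def trace_mul_sym[of B A])
  then have "Im (trace_inner A B) = 0"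
    by (simp add: complex_eq_iff)
  then show ?thesis
    by (simp add: complex_eq_iff Re_trace_inner)
qed

section \<open>The cone of positive-definite matrices\<close>

lemma mem_hpd: "A \<in> hpd \<longleftrightarrow> hermitian A \<and> (\<forall>x. x \<noteq> 0 \<longrightarrow> 0 < x \<bullet> (A *v x))"
  by (simp add: hpd_def inner_vec_def inner_complex_def)

lemma hpd_hermitian: "A \<in> hpd \<Longrightarrow> hermitian A"
  by (simp add: mem_hpd)

lemma hpd_invertible:
  assumes "A \<in> hpd"
  shows "invertible A"
proof -
  have "x = 0" if "A *v x = 0" for x
    using assms that by (force simp: mem_hpd)
  then show ?thesis
    using matrix_left_invertible_ker invertible_left_inverse by blast
qed

text \<open>The quadratic form is affine in the matrix. The segment serves as the path along which
  the sign of the determinant is followed.\<close>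

lemma hpd_convex_mat_1:
  assumes "A \<in> hpd" "0 \<le> s" "s \<le> 1"
  shows "(1 - s) *\<^sub>R mat 1 + s *\<^sub>R A \<in> hpd"
proof -
  have "0 < x \<bullet> (((1 - s) *\<^sub>R mat 1 + s *\<^sub>R A) *v x)" if "x \<noteq> 0" for x
  proof -
    have "0 < x \<bullet> x" "0 < x \<bullet> (A *v x)"
      using assms that by (auto simp: mem_hpd)
    moreover have "x \<bullet> (((1 - s) *\<^sub>R mat 1 + s *\<^sub>R A) *v x) = (1 - s) * (x \<bullet> x) + s * (x \<bullet> (A *v x))"
      by (simp add: matrix_vector_mult_add_rdistrib matrix_vector_mult_scaleR_complex inner_add_right)
    ultimately show ?thesis
      using assms(2,3) by (cases "s = 0") (auto intro: add_nonneg_pos)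
  qed
  then show ?thesis
    using assms by (simp add: mem_hpd hermitian_add hermitian_scaleR hermitian_mat_1)
qed

lemma hermitian_det_real: "hermitian A \<Longrightarrow> Im (det A) = 0"
  using cnj_det[of A] by (simp add: hermitian_def complex_eq_iff)

text \<open>On the segment from the identity to \<open>A\<close> the determinant is real and never vanishes, so
  its sign is that of \<open>det 1\<close>.\<close>

lemma hpd_det_pos:
  assumes "A \<in> hpd"
  shows "0 < Re (det A)"
proof (rule ccontr)
  assume neg: "\<not> 0 < Re (det A)"
  define f where "f s = Re (det ((1 - s) *\<^sub>R mat 1 + s *\<^sub>R A))" for s
  have "continuous_on {0..1} f"
    unfolding f_def det_def by (intro continuous_intros)
  moreover have "f 1 \<le> 0" "0 \<le> f 0"
    using neg by (simp_all add: f_def)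
  ultimately obtain s where s: "0 \<le> s" "s \<le> 1" "f s = 0"
    using IVT2'[of f 1 0 0] by auto
  let ?B = "(1 - s) *\<^sub>R mat 1 + s *\<^sub>R A"
  have B: "?B \<in> hpd"
    using assms s by (simp add: hpd_convex_mat_1)
  have "det ?B = 0"
    using s hermitian_det_real[OF hpd_hermitian[OF B]] by (simp add: f_def complex_eq_iff)
  then show False
    using hpd_invertible[OF B] by (simp add: invertible_det_nz)
qed

text \<open>On the compact unit sphere the form of \<open>A\<close> has a positive minimum
  \<open>c\<close>, while that of \<open>V\<close> is bounded by some \<open>K\<close>, so
  \<open>\<delta> = c / K\<close> works. A minimizer can thus be perturbed in both directions of a
  Hermitian line.\<close>

lemma hpd_open_direction:
  assumes "A \<in> hpd" "hermitian V"
  obtains \<delta> where "\<delta> > 0" "\<And>t. \<bar>t\<bar> < \<delta> \<Longrightarrow> A + t *\<^sub>R V \<in> hpd"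
proof -
  let ?S = "sphere (0 :: complex^'a) 1"
  have lin: "bounded_linear ((*v) B)" for B :: "'a cmat"
    using linear_conv_bounded_linear matrix_vector_mul_linear by blast
  have "compact ?S" "?S \<noteq> {}"
    by auto
  moreover have "continuous_on ?S (\<lambda>x. x \<bullet> (A *v x))"
    by (intro continuous_intros linear_continuous_on lin)
  ultimately obtain x0 where x0: "x0 \<in> ?S" "\<And>x. x \<in> ?S \<Longrightarrow> x0 \<bullet> (A *v x0) \<le> x \<bullet> (A *v x)"
    by (blast dest: continuous_attains_inf)
  define c where "c = x0 \<bullet> (A *v x0)"
  have "c > 0"
    using assms(1) x0(1) by (cases "x0 = 0") (auto simp: c_def mem_hpd)
  obtain K where K: "K > 0" "\<And>x. norm (V *v x) \<le> norm x * K"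
    using bounded_linear.pos_bounded[OF lin[of V]] by blast
  have "A + t *\<^sub>R V \<in> hpd" if t: "\<bar>t\<bar> < c / K" for t
  proof -
    have "0 < x \<bullet> ((A + t *\<^sub>R V) *v x)" if "x \<noteq> 0" for x
    proof -
      define u where "u = x /\<^sub>R norm x"
      have u: "norm u = 1" and x: "x = norm x *\<^sub>R u"
        using that by (simp_all add: u_def)
      have "\<bar>u \<bullet> (V *v u)\<bar> \<le> K"
        using Cauchy_Schwarz_ineq2[of u "V *v u"] K(2)[of u] u by simp
      then have "\<bar>t * (u \<bullet> (V *v u))\<bar> \<le> \<bar>t\<bar> * K"
        by (simp add: abs_mult mult_left_mono)
      also have "\<dots> < c"
        using t K(1) by (simp add: field_simps)
      finally have "0 < u \<bullet> (A *v u) + t * (u \<bullet> (V *v u))"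
        using x0(2)[of u] u by (auto simp: c_def)
      also have "\<dots> = u \<bullet> ((A + t *\<^sub>R V) *v u)"
        by (simp add: matrix_vector_mult_add_rdistrib matrix_vector_mult_scaleR_complex inner_add_right)
      \<comment> \<open>The quadratic form is homogeneous of degree two, which carries positivity
        from the unit vector \<open>u\<close> back to \<open>x\<close>.\<close>
      finally have "0 < norm x * (norm x * (u \<bullet> ((A + t *\<^sub>R V) *v u)))"
        using that by simp
      also have "\<dots> = x \<bullet> ((A + t *\<^sub>R V) *v x)"
        by (subst (3 4) x) (simp add: matrix_vector_mult_scaleR_complex)
      finally show ?thesis .
    qed
    then show ?thesis
      using assms by (simp add: mem_hpd hermitian_add hermitian_scaleR)
  qed
  moreover have "c / K > 0"
    using \<open>c > 0\<close> K(1) by simp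
  ultimately show ?thesis
    using that[of "c / K"] by simp
qed

section \<open>Derivative of the determinant and gradient of its negative logarithm\<close>

text \<open>A permutation other than the identity moves at least two points, so its product in the
  Leibniz formula vanishes to second order.\<close>

lemma DERIV_det_mat_1:
  fixes A :: "'a::real_normed_field^'n::finite^'n"
  shows "((\<lambda>z. det (\<chi> i j. mat 1 $ i $ j + z * A $ i $ j)) has_field_derivative trace A) (at 0)"
proof -
  let ?D = "\<lambda>p. \<Sum>i\<in>UNIV. A $ i $ p i * (\<Prod>j\<in>UNIV - {i}. mat 1 $ j $ p j)"
  have nonid: "?D p = 0" if p: "p permutes (UNIV :: 'n set)" "p \<noteq> id" for p
  proof (rule sum.neutral, safe)
    fix i
    obtain k where k: "p k \<noteq> k"
      using p(2) by (auto simp: fun_eq_iff)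
    \<comment> \<open>By injectivity \<open>p k\<close> is a second moved point. One of
      \<open>k\<close> and \<open>p k\<close> differs from \<open>i\<close>, and there the identity
      matrix contributes a zero factor.\<close>
    then have "p (p k) \<noteq> p k"
      using permutes_inj[OF p(1)] by (auto dest: injD)
    with k obtain j where "j \<noteq> i" "j \<noteq> p j"
      by metis
    then have "(\<Prod>j\<in>UNIV - {i}. (mat 1 :: 'a^'n^'n) $ j $ p j) = 0"
      by (intro prod_zero bexI[of _ j]) (auto simp: mat_def)
    then show "A $ i $ p i * (\<Prod>j\<in>UNIV - {i}. mat 1 $ j $ p j) = 0"
      by simp
  qed
  have "((\<lambda>z. \<Prod>i\<in>UNIV. mat 1 $ i $ p i + z * A $ i $ p i) has_field_derivative ?D p) (at 0)" for p
    by (rule DERIV_cong[OF has_field_derivative_prod[where f' = "\<lambda>i. A $ i $ p i"]])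
      (auto intro!: derivative_eq_intros)
  then have "((\<lambda>z. det (\<chi> i j. mat 1 $ i $ j + z * A $ i $ j)) has_field_derivative
      (\<Sum>p\<in>{p. p permutes (UNIV :: 'n set)}. of_int (sign p) * ?D p)) (at 0)"
    unfolding det_def by (auto intro!: DERIV_sum DERIV_cmult)
  moreover have "(\<Sum>p\<in>{p. p permutes (UNIV :: 'n set)}. of_int (sign p) * ?D p)
      = (\<Sum>p\<in>{id}. of_int (sign p) * ?D p)"
    using nonid by (intro sum.mono_neutral_right) (auto simp: permutes_id)
  moreover have "\<dots> = trace A"
    by (simp add: trace_def mat_def sign_id)
  ultimately show ?thesis
    by simp
qed

text \<open>Jacobi's formula: pulling \<open>A\<close> out of \<open>A + t V\<close> on the left
  reduces it to the derivative at the identity.\<close>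

lemma DERIV_det_add:
  fixes A V :: "'n::finite cmat"
  assumes "invertible A"
  shows "((\<lambda>t. det (A + t *\<^sub>R V)) has_vector_derivative det A * trace (matrix_inv A ** V)) (at 0)"
proof -
  let ?B = "matrix_inv A ** V"
  have "det (A + t *\<^sub>R V) = det A * det (\<chi> i j. mat 1 $ i $ j + of_real t * ?B $ i $ j)" for t
  proof -
    have "A ** (mat 1 + t *\<^sub>R ?B) = A + t *\<^sub>R V"
      using assms by (simp add: matrix_mult.add_right matrix_mult.scaleR_right matrix_mul_assoc matrix_inv_mult)
    moreover have "mat 1 + t *\<^sub>R ?B = (\<chi> i j. mat 1 $ i $ j + of_real t * ?B $ i $ j)"
      by (simp add: vec_eq_iff scaleR_conv_of_real[where 'a = complex])
    ultimately show ?thesis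
      by (metis det_mul)
  qed
  moreover have "((\<lambda>t. det (\<chi> i j. mat 1 $ i $ j + of_real t * ?B $ i $ j))
      has_vector_derivative trace ?B) (at 0)"
    by (rule has_vector_derivative_real_field) (simp add: DERIV_det_mat_1)
  ultimately show ?thesis
    by (simp add: has_vector_derivative_mult_right)
qed

text \<open>The chain rule for the logarithm cancels the factor \<open>det A\<close> of Jacobi's
  formula; the remaining trace is real because \<open>matrix_inv A\<close> and \<open>V\<close> are
  Hermitian.\<close>

lemma DERIV_neg_log_det:
  assumes "A \<in> hpd" "hermitian V"
  shows "((\<lambda>t. neg_log_det (A + t *\<^sub>R V)) has_real_derivative (- matrix_inv A) \<bullet> V) (at 0)"
proof -
  let ?B = "matrix_inv A"
  have inv: "invertible A" and herm: "hermitian ?B"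
    using assms(1) hpd_invertible hpd_hermitian hermitian_matrix_inv by blast+
  have "trace (?B ** V) = trace_inner ?B V"
    using herm by (simp add: trace_inner_def hermitian_def)
  also have "\<dots> = of_real (?B \<bullet> V)"
    using herm assms(2) by (rule trace_inner_hermitian_real)
  finally have tr: "trace (?B ** V) = of_real (?B \<bullet> V)" .
  have "((\<lambda>t. Re (det (A + t *\<^sub>R V))) has_vector_derivative Re (det A * trace (?B ** V))) (at 0)"
    by (rule bounded_linear.has_vector_derivative[OF bounded_linear_Re DERIV_det_add[OF inv]])
  then have *: "((\<lambda>t. Re (det (A + t *\<^sub>R V))) has_real_derivative Re (det A) * (?B \<bullet> V)) (at 0)"
    by (simp add: has_real_derivative_iff_has_vector_derivative tr)
  have pos: "0 < Re (det (A + 0 *\<^sub>R V))"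
    using hpd_det_pos[OF assms(1)] by simp
  show ?thesis
    unfolding neg_log_det_def using pos
    by (intro DERIV_cong[OF DERIV_minus[OF DERIV_chain2[OF DERIV_ln[OF pos] *]]]) simp
qed

lemma has_gradient_neg_log_det:
  assumes "A \<in> hpd"
  shows "has_gradient neg_log_det A (- matrix_inv A)"
proof -
  have herm: "hermitian (- matrix_inv A)"
    using assms by (simp add: hermitian_minus hermitian_matrix_inv hpd_invertible hpd_hermitian)
  have "((\<lambda>t. complex_of_real (neg_log_det (A + t *\<^sub>R V)))
      has_vector_derivative trace_inner (- matrix_inv A) V) (at 0)" if "hermitian V" for V
    unfolding trace_inner_hermitian_real[OF herm that]
    using DERIV_neg_log_det[OF assms that] by (rule has_vector_derivative_of_real)
  with herm show ?thesis
    by (simp add: has_gradient_def)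
qed

text \<open>The difference of two gradients is itself an admissible Hermitian direction, and testing
  both on it gives a difference of norm zero.\<close>

lemma has_gradient_unique:
  assumes "has_gradient F A G" "has_gradient F A G'"
  shows "G = G'"
proof -
  have herm: "hermitian (G - G')"
    using assms by (simp add: has_gradient_def hermitian_diff)
  then have "trace_inner G (G - G') = trace_inner G' (G - G')"
    using assms unfolding has_gradient_def by (metis vector_derivative_unique_at)
  then have "(G - G') \<bullet> (G - G') = 0"
    by (metis Re_trace_inner inner_diff_left right_minus_eq)
  then show ?thesis by simp
qed

lemma gradient_neg_log_det:
  assumes "A \<in> hpd"
  shows "gradient neg_log_det A = - matrix_inv A"
  unfolding gradient_def using has_gradient_neg_log_det[OF assms] has_gradient_unique
  by (intro the_equality) auto

section \<open>The TLD divergence and stationarity of its means\<close>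

text \<open>The normalizing factor of the total Bregman divergence with second argument
  \<open>A\<close>, where the gradient is \<open>- matrix_inv A\<close>.\<close>

definition tld_weight :: "'N::finite cmat \<Rightarrow> real" where
  "tld_weight A = 1 / sqrt (1 + (frob_norm (matrix_inv A))\<^sup>2)"

lemma tld_weight_pos: "tld_weight A > 0"
  unfolding tld_weight_def by (simp add: add_pos_nonneg)

text \<open>Only the first argument moves, so the weight of \<open>B\<close> is constant and the
  linear term contributes \<open>matrix_inv B\<close>.\<close>

lemma DERIV_total_bregman_neg_log_det:
  assumes "A \<in> hpd" "B \<in> hpd" "hermitian V"
  shows "((\<lambda>t. total_bregman neg_log_det (A + t *\<^sub>R V) B) has_real_derivative
    (tld_weight B *\<^sub>R (matrix_inv B - matrix_inv A)) \<bullet> V) (at 0)"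
proof -
  have eq: "total_bregman neg_log_det (A + t *\<^sub>R V) B =
      (neg_log_det (A + t *\<^sub>R V) - neg_log_det B + matrix_inv B \<bullet> (A - B) + t * (matrix_inv B \<bullet> V))
        * tld_weight B" for t
    using assms(2)
    by (simp add: total_bregman_def gradient_neg_log_det tld_weight_def Re_trace_inner frob_norm_eq_norm
        inner_add_right inner_diff_right)
  show ?thesis
    unfolding eq
    by (auto intro!: derivative_eq_intros DERIV_neg_log_det[OF assms(1,3)]
        simp: inner_diff_left algebra_simps)
qed

text \<open>The gradient \<open>?Z\<close> of the objective is Hermitian, so the minimizer may be
  perturbed along \<open>?Z\<close> itself; the vanishing derivative is then the squared norm of
  \<open>?Z\<close>.\<close>

lemma contaminated_mean_stationary:
  assumes X: "\<And>i. i \<in> {1..m} \<Longrightarrow> X i \<in> hpd" and P: "\<And>j. j \<in> {1..n} \<Longrightarrow> P j \<in> hpd"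
    and M: "is_contaminated_tbd_mean neg_log_det m X n P \<epsilon> M"
  shows "M \<in> hpd"
    and "((1 - \<epsilon>) / real m) *\<^sub>R (\<Sum>i=1..m. tld_weight (X i) *\<^sub>R (matrix_inv (X i) - matrix_inv M))
      + (\<epsilon> / real n) *\<^sub>R (\<Sum>j=1..n. tld_weight (P j) *\<^sub>R (matrix_inv (P j) - matrix_inv M)) = 0"
      (is "?Z = 0")
proof -
  let ?f = "\<lambda>Y. (1 - \<epsilon>) * ((1 / real m) * (\<Sum>i=1..m. total_bregman neg_log_det Y (X i)))
            + \<epsilon> * ((1 / real n) * (\<Sum>j=1..n. total_bregman neg_log_det Y (P j)))"
  show hpd: "M \<in> hpd"
    using M by (simp add: is_contaminated_tbd_mean_def is_arg_min_def)
  have min: "?f M \<le> ?f Y" if "Y \<in> hpd" for Y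
    using M that unfolding is_contaminated_tbd_mean_def is_arg_min_def by force
  have herm: "hermitian ?Z"
    using X P hpd by (intro hermitian_add hermitian_scaleR hermitian_sum hermitian_diff
        hermitian_matrix_inv hpd_hermitian hpd_invertible)
  obtain \<delta> where \<delta>: "\<delta> > 0" "\<And>t. \<bar>t\<bar> < \<delta> \<Longrightarrow> M + t *\<^sub>R ?Z \<in> hpd"
    using hpd_open_direction[OF hpd herm] by blast
  have "((\<lambda>t. ?f (M + t *\<^sub>R ?Z)) has_real_derivative
      (1 - \<epsilon>) * ((1 / real m) * (\<Sum>i=1..m. (tld_weight (X i) *\<^sub>R (matrix_inv (X i) - matrix_inv M)) \<bullet> ?Z))
      + \<epsilon> * ((1 / real n) * (\<Sum>j=1..n. (tld_weight (P j) *\<^sub>R (matrix_inv (P j) - matrix_inv M)) \<bullet> ?Z))) (at 0)"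
    by (intro DERIV_add DERIV_cmult DERIV_sum DERIV_total_bregman_neg_log_det hpd herm X P)
  \<comment> \<open>An arbitrary \<open>V\<close> keeps the right factor opaque while the left one
    is expanded by linearity.\<close>
  moreover have "(1 - \<epsilon>) * ((1 / real m) * (\<Sum>i=1..m. (tld_weight (X i) *\<^sub>R (matrix_inv (X i) - matrix_inv M)) \<bullet> V))
      + \<epsilon> * ((1 / real n) * (\<Sum>j=1..n. (tld_weight (P j) *\<^sub>R (matrix_inv (P j) - matrix_inv M)) \<bullet> V))
      = ?Z \<bullet> V" for V
    by (simp add: inner_add_left inner_sum_left)
  ultimately have "((\<lambda>t. ?f (M + t *\<^sub>R ?Z)) has_real_derivative ?Z \<bullet> ?Z) (at 0)"
    by metis
  moreover have "\<forall>t. \<bar>0 - t\<bar> < \<delta> \<longrightarrow> ?f (M + 0 *\<^sub>R ?Z) \<le> ?f (M + t *\<^sub>R ?Z)"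
    using \<delta>(2) min by simp
  ultimately have "?Z \<bullet> ?Z = 0"
    by (rule DERIV_local_min[OF _ \<delta>(1)])
  then show "?Z = 0" by simp
qed

text \<open>With this, one stationarity lemma serves both means.\<close>

lemma is_tbd_mean_iff_uncontaminated:
  "is_tbd_mean F m X M \<longleftrightarrow> is_contaminated_tbd_mean F m X n P 0 M"
  by (simp add: is_tbd_mean_def is_contaminated_tbd_mean_def)

section \<open>First-order expansions in the contamination weight\<close>

text \<open>Subtracting two expansions bounds \<open>\<epsilon> (H - H')\<close> by a multiple of
  \<open>\<epsilon>\<^sup>2\<close>; divide by \<open>\<epsilon>\<close> and let it tend to zero.
  This makes the definite description in \<open>influence_matrix\<close> meaningful.\<close>

lemma first_order_coeff_unique:
  assumes "is_first_order_coeff Z A H" "is_first_order_coeff Z A H'"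
  shows "H = H'"
proof -
  obtain c where c: "\<forall>\<^sub>F \<epsilon> in at_right 0. norm (Z \<epsilon> - (A + \<epsilon> *\<^sub>R H)) \<le> c * \<epsilon>\<^sup>2"
    using assms(1) by (auto simp: is_first_order_coeff_def frob_norm_eq_norm elim: landau_o.bigE)
  obtain c' where c': "\<forall>\<^sub>F \<epsilon> in at_right 0. norm (Z \<epsilon> - (A + \<epsilon> *\<^sub>R H')) \<le> c' * \<epsilon>\<^sup>2"
    using assms(2) by (auto simp: is_first_order_coeff_def frob_norm_eq_norm elim: landau_o.bigE)
  have "\<forall>\<^sub>F \<epsilon> :: real in at_right 0. 0 < \<epsilon>"
    by (simp add: eventually_at_right_less)
  with c c' have "\<forall>\<^sub>F \<epsilon> in at_right 0. norm (H - H') \<le> (c + c') * \<epsilon>"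
  proof eventually_elim
    case (elim \<epsilon>)
    have "\<epsilon> *\<^sub>R (H - H') = (Z \<epsilon> - (A + \<epsilon> *\<^sub>R H')) - (Z \<epsilon> - (A + \<epsilon> *\<^sub>R H))"
      by (simp add: algebra_simps)
    then have "norm (\<epsilon> *\<^sub>R (H - H')) \<le> c' * \<epsilon>\<^sup>2 + c * \<epsilon>\<^sup>2"
      using norm_triangle_ineq4 elim(1,2) by (smt (verit))
    also have "norm (\<epsilon> *\<^sub>R (H - H')) = \<epsilon> * norm (H - H')"
      using elim(3) by simp
    also have "c' * \<epsilon>\<^sup>2 + c * \<epsilon>\<^sup>2 = \<epsilon> * ((c + c') * \<epsilon>)"
      by (simp add: algebra_simps power2_eq_square)
    finally have "\<epsilon> * norm (H - H') \<le> \<epsilon> * ((c + c') * \<epsilon>)" .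
    then show ?case
      using elim(3) by simp
  qed
  moreover have "((\<lambda>\<epsilon>. (c + c') * \<epsilon>) \<longlongrightarrow> (c + c') * 0) (at_right 0)"
    by (intro tendsto_intros)
  ultimately have "norm (H - H') \<le> (c + c') * 0"
    using tendsto_lowerbound trivial_limit_at_right_real by blast
  then show ?thesis by simp
qed

text \<open>Since \<open>Z = A - c Z D A\<close>, the path \<open>Z\<close> stays bounded, and substituting the identity into
  itself gives \<open>Z = A - c A D A + O(c\<^sup>2)\<close>.\<close>

lemma first_order_coeff_of_inverse:
  fixes A D :: "'N::finite cmat" and c :: "real \<Rightarrow> real"
  assumes inv: "invertible A"
    and Z: "\<forall>\<^sub>F \<epsilon> in at_right 0. Z \<epsilon> ** (matrix_inv A + c \<epsilon> *\<^sub>R D) = mat 1"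
    and c: "(\<lambda>\<epsilon>. c \<epsilon> - \<kappa> * \<epsilon>) \<in> O[at_right 0](\<lambda>\<epsilon>. \<epsilon>\<^sup>2)"
  shows "is_first_order_coeff Z A (- \<kappa> *\<^sub>R (A ** D ** A))"
proof -
  obtain K where K: "K > 0" "\<And>(P :: 'N cmat) (Q :: 'N cmat). norm (P ** Q) \<le> norm P * norm Q * K"
    using matrix_mult.pos_bounded by blast
  \<comment> \<open>Right multiplication by \<open>E\<close> is the map iterated below, and
    \<open>L\<close> bounds its operator norm.\<close>
  define E where "E = D ** A"
  define L where "L = norm E * K"
  have "L \<ge> 0"
    using K(1) by (simp add: L_def)
  have L: "norm (P ** E) \<le> norm P * L" for P :: "'N cmat"
    using K(2)[of P E] by (simp add: L_def mult.assoc)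
  have "(\<lambda>\<epsilon>::real. \<epsilon>\<^sup>2) \<in> O[at_right 0](\<lambda>\<epsilon>. \<epsilon>)"
  proof (rule bigoI)
    have "\<forall>\<^sub>F \<epsilon> :: real in at_right 0. \<epsilon> \<in> {0<..<1}"
      by (rule eventually_at_right_real) simp
    then show "\<forall>\<^sub>F \<epsilon> :: real in at_right 0. norm (\<epsilon>\<^sup>2) \<le> 1 * norm \<epsilon>"
      by eventually_elim (simp add: power2_eq_square mult_left_le)
  qed
  then have "(\<lambda>\<epsilon>. c \<epsilon> - \<kappa> * \<epsilon>) \<in> O[at_right 0](\<lambda>\<epsilon>. \<epsilon>)"
    using c landau_o.big_trans by blast
  moreover have "(\<lambda>\<epsilon>. \<kappa> * \<epsilon>) \<in> O[at_right 0](\<lambda>\<epsilon>. \<epsilon>)"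
    by (cases "\<kappa> = 0") simp_all
  ultimately have "(\<lambda>\<epsilon>. (c \<epsilon> - \<kappa> * \<epsilon>) + \<kappa> * \<epsilon>) \<in> O[at_right 0](\<lambda>\<epsilon>. \<epsilon>)"
    by (rule sum_in_bigo)
  then have c1: "c \<in> O[at_right 0](\<lambda>\<epsilon>. \<epsilon>)"
    by simp
  obtain C where C: "\<forall>\<^sub>F \<epsilon> in at_right 0. norm (c \<epsilon>) \<le> C * norm \<epsilon>"
    using c1 by (auto elim: landau_o.bigE)
  have "((\<lambda>\<epsilon>. C * norm \<epsilon>) \<longlongrightarrow> 0) (at_right (0::real))"
    by (auto intro!: tendsto_eq_intros)
  then have c0: "(c \<longlongrightarrow> 0) (at_right 0)"
    using C by (auto intro: Lim_null_comparison)
  have "((\<lambda>\<epsilon>. \<bar>c \<epsilon>\<bar> * L) \<longlongrightarrow> \<bar>0\<bar> * L) (at_right 0)"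
    by (intro tendsto_intros c0)
  \<comment> \<open>The threshold \<open>1 / 2\<close> allows the term in \<open>Z\<close> to be
    absorbed: \<open>Z - A\<close> has at most half the norm of \<open>Z\<close>, so
    \<open>Z\<close> has at most twice the norm of \<open>A\<close>.\<close>
  then have small: "\<forall>\<^sub>F \<epsilon> in at_right 0. \<bar>c \<epsilon>\<bar> * L < 1 / 2"
    by (rule order_tendstoD) simp
  have "\<forall>\<^sub>F \<epsilon> in at_right 0. norm (Z \<epsilon> - (A + \<epsilon> *\<^sub>R (- \<kappa> *\<^sub>R (A ** D ** A))))
      \<le> (c \<epsilon>)\<^sup>2 * (2 * norm A * L\<^sup>2) + \<bar>c \<epsilon> - \<kappa> * \<epsilon>\<bar> * norm (A ** E)"
    using Z small
  proof eventually_elim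
    case (elim \<epsilon>)
    have "A = Z \<epsilon> ** (matrix_inv A + c \<epsilon> *\<^sub>R D) ** A"
      using elim(1) by simp
    also have "\<dots> = Z \<epsilon> ** (matrix_inv A ** A) + c \<epsilon> *\<^sub>R (Z \<epsilon> ** E)"
      by (simp add: E_def matrix_mult.add_left matrix_mult.add_right matrix_mult.scaleR_left
          matrix_mult.scaleR_right matrix_mul_assoc)
    also have "\<dots> = Z \<epsilon> + c \<epsilon> *\<^sub>R (Z \<epsilon> ** E)"
      using inv by (simp add: matrix_inv_mult)
    finally have step: "Z \<epsilon> - A = - (c \<epsilon> *\<^sub>R (Z \<epsilon> ** E))"
      by (simp add: algebra_simps)
    have diff: "norm (Z \<epsilon> - A) \<le> \<bar>c \<epsilon>\<bar> * (norm (Z \<epsilon>) * L)"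
      unfolding step using L[of "Z \<epsilon>"] by (simp add: mult_left_mono)
    also have "\<dots> \<le> norm (Z \<epsilon>) * (1 / 2)"
      using elim(2) mult_left_mono[of "\<bar>c \<epsilon>\<bar> * L" "1/2" "norm (Z \<epsilon>)"] by (simp add: ac_simps)
    finally have "norm (Z \<epsilon>) \<le> 2 * norm A"
      using norm_triangle_sub[of "Z \<epsilon>" A] by simp
    then have "norm (Z \<epsilon>) * L \<le> 2 * norm A * L"
      using \<open>L \<ge> 0\<close> by (rule mult_right_mono)
    then have diff': "norm (Z \<epsilon> - A) \<le> \<bar>c \<epsilon>\<bar> * (2 * norm A * L)"
      using diff mult_left_mono[of _ _ "\<bar>c \<epsilon>\<bar>"] by (smt (verit) abs_ge_zero)
    \<comment> \<open>Splitting \<open>Z = (Z - A) + A\<close> inside \<open>step\<close> isolates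
      the linear term; the rest carries \<open>c\<close> times \<open>Z - A\<close>, hence is
      quadratic in \<open>c\<close>.\<close>
    have "Z \<epsilon> - (A + \<epsilon> *\<^sub>R (- \<kappa> *\<^sub>R (A ** D ** A)))
        = - (c \<epsilon> *\<^sub>R ((Z \<epsilon> - A) ** E)) - (c \<epsilon> - \<kappa> * \<epsilon>) *\<^sub>R (A ** E)"
    proof -
      have "A ** D ** A = A ** E"
        by (simp add: E_def matrix_mul_assoc)
      then show ?thesis
        using step by (simp add: matrix_mult.diff_left algebra_simps)
    qed
    also have "norm \<dots> \<le> \<bar>c \<epsilon>\<bar> * norm ((Z \<epsilon> - A) ** E) + \<bar>c \<epsilon> - \<kappa> * \<epsilon>\<bar> * norm (A ** E)"
      by (rule order_trans[OF norm_triangle_ineq4]) simp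
    also have "\<bar>c \<epsilon>\<bar> * norm ((Z \<epsilon> - A) ** E) \<le> \<bar>c \<epsilon>\<bar> * (\<bar>c \<epsilon>\<bar> * (2 * norm A * L) * L)"
      using L[of "Z \<epsilon> - A"] mult_right_mono[OF diff' \<open>L \<ge> 0\<close>] by (intro mult_left_mono) linarith+
    also have "\<dots> = (c \<epsilon>)\<^sup>2 * (2 * norm A * L\<^sup>2)"
      by (simp add: power2_eq_square)
    finally show ?case by simp
  qed
  then have "(\<lambda>\<epsilon>. norm (Z \<epsilon> - (A + \<epsilon> *\<^sub>R (- \<kappa> *\<^sub>R (A ** D ** A))))) 
      \<in> O[at_right 0](\<lambda>\<epsilon>. (c \<epsilon>)\<^sup>2 * (2 * norm A * L\<^sup>2) + \<bar>c \<epsilon> - \<kappa> * \<epsilon>\<bar> * norm (A ** E))"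
    by (intro bigoI[where c = 1]) (auto elim!: eventually_mono)
  also have "(\<lambda>\<epsilon>. (c \<epsilon>)\<^sup>2 * (2 * norm A * L\<^sup>2) + \<bar>c \<epsilon> - \<kappa> * \<epsilon>\<bar> * norm (A ** E)) \<in> O[at_right 0](\<lambda>\<epsilon>. \<epsilon>\<^sup>2)"
  proof (rule sum_in_bigo)
    have "(\<lambda>\<epsilon>. (c \<epsilon>)\<^sup>2) \<in> O[at_right 0](\<lambda>\<epsilon>. \<epsilon>\<^sup>2)"
      using landau_o.big_power[OF c1] .
    then show "(\<lambda>\<epsilon>. (c \<epsilon>)\<^sup>2 * (2 * norm A * L\<^sup>2)) \<in> O[at_right 0](\<lambda>\<epsilon>. \<epsilon>\<^sup>2)"
      by (cases "2 * norm A * L\<^sup>2 = 0") (auto simp del: mult_eq_0_iff)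
    show "(\<lambda>\<epsilon>. \<bar>c \<epsilon> - \<kappa> * \<epsilon>\<bar> * norm (A ** E)) \<in> O[at_right 0](\<lambda>\<epsilon>. \<epsilon>\<^sup>2)"
      using c by (cases "norm (A ** E) = 0") (auto simp del: norm_eq_zero)
  qed
  finally show ?thesis
    by (simp add: is_first_order_coeff_def frob_norm_eq_norm)
qed

lemma sum_scaleR_diff:
  fixes W :: "'a::real_vector"
  shows "(\<Sum>i\<in>I. w i *\<^sub>R (B i - W)) = (\<Sum>i\<in>I. w i *\<^sub>R B i) - (\<Sum>i\<in>I. w i) *\<^sub>R W"
  by (simp add: scaleR_diff_right sum_subtractf scaleR_sum_left)

text \<open>The remainder is exactly \<open>\<epsilon>\<^sup>2\<close> times
  \<open>(a - b) / (a d)\<close> with \<open>d\<close> the denominator of \<open>c\<close>, and this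
  factor is bounded because \<open>d\<close> tends to \<open>a > 0\<close>. The derivative at zero
  is for the path of gradients.\<close>

lemma contamination_ratio_expansion:
  fixes a b :: real
  assumes "a > 0"
  defines "c \<equiv> \<lambda>\<epsilon>. \<epsilon> / ((1 - \<epsilon>) * a + \<epsilon> * b)"
  shows "(\<lambda>\<epsilon>. c \<epsilon> - 1 / a * \<epsilon>) \<in> O[at_right 0](\<lambda>\<epsilon>. \<epsilon>\<^sup>2)"
    and "(c has_real_derivative 1 / a) (at 0)"
proof -
  let ?d = "\<lambda>\<epsilon>. (1 - \<epsilon>) * a + \<epsilon> * b"
  have d: "(?d \<longlongrightarrow> a) (at_right 0)"
    by (auto intro!: tendsto_eq_intros)
  have "((\<lambda>\<epsilon>. (a - b) / (a * ?d \<epsilon>)) \<longlongrightarrow> (a - b) / (a * a)) (at_right 0)"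
    using assms(1) by (intro tendsto_intros d) simp
  then have "(\<lambda>\<epsilon>. (a - b) / (a * ?d \<epsilon>)) \<in> O[at_right 0](\<lambda>_. 1)"
    by (rule bigoI_tendsto[where g = "\<lambda>_. 1", simplified])
  then have "(\<lambda>\<epsilon>. \<epsilon>\<^sup>2 * ((a - b) / (a * ?d \<epsilon>))) \<in> O[at_right 0](\<lambda>\<epsilon>. \<epsilon>\<^sup>2 * 1)"
    by (rule landau_o.big.mult_left)
  moreover have "\<forall>\<^sub>F \<epsilon> in at_right 0. c \<epsilon> - 1 / a * \<epsilon> = \<epsilon>\<^sup>2 * ((a - b) / (a * ?d \<epsilon>))"
    using order_tendstoD(1)[OF d assms(1)]
  proof eventually_elim
    case (elim \<epsilon>)
    then have "?d \<epsilon> \<noteq> 0" by simp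
    have "c \<epsilon> - 1 / a * \<epsilon> = \<epsilon> * (a - ?d \<epsilon>) / (a * ?d \<epsilon>)"
      using assms(1) \<open>?d \<epsilon> \<noteq> 0\<close> unfolding c_def by (simp add: diff_frac_eq algebra_simps)
    also have "a - ?d \<epsilon> = \<epsilon> * (a - b)"
      by (simp add: algebra_simps)
    finally show ?case
      by (simp add: power2_eq_square)
  qed
  ultimately show "(\<lambda>\<epsilon>. c \<epsilon> - 1 / a * \<epsilon>) \<in> O[at_right 0](\<lambda>\<epsilon>. \<epsilon>\<^sup>2)"
    by (simp add: landau_o.big.in_cong)
  show "(c has_real_derivative 1 / a) (at 0)"
    unfolding c_def using assms(1) by (auto intro!: derivative_eq_intros)
qed

theorem proposition12:
  fixes m n :: nat
    and X P :: "nat \<Rightarrow> 'N::finite cmat"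
    and Xbar :: "'N cmat"
    and Xhat :: "real \<Rightarrow> 'N cmat"
    and \<epsilon>\<^sub>0 :: real
  assumes "m \<ge> 1" and "n \<ge> 1"
    and "\<And>i. i \<in> {1..m} \<Longrightarrow> X i \<in> hpd"
    and "\<And>j. j \<in> {1..n} \<Longrightarrow> P j \<in> hpd"
    and "is_tbd_mean neg_log_det m X Xbar"
    and "\<epsilon>\<^sub>0 > 0"
    and "\<And>\<epsilon>. 0 \<le> \<epsilon> \<Longrightarrow> \<epsilon> < \<epsilon>\<^sub>0 \<Longrightarrow>
           is_contaminated_tbd_mean neg_log_det m X n P \<epsilon> (Xhat \<epsilon>)"
  shows "(\<forall>Y \<in> (hpd :: 'N cmat set). has_gradient neg_log_det Y (- matrix_inv Y) \<and>
            gradient neg_log_det Y = - matrix_inv Y) \<and>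
         is_first_order_coeff Xhat Xbar (influence_matrix Xhat Xbar) \<and>
         ((\<lambda>\<epsilon>. gradient neg_log_det (Xhat \<epsilon>)) has_vector_derivative
            matrix_inv Xbar ** influence_matrix Xhat Xbar ** matrix_inv Xbar)
           (at 0 within {0..}) \<and>
         influence_function Xhat Xbar = frob_norm (influence_matrix Xhat Xbar) \<and>
         influence_matrix Xhat Xbar =
           (real m / real n * inverse (\<Sum>i=1..m. 1 / sqrt (1 + (frob_norm (matrix_inv (X i)))\<^sup>2)))
             *\<^sub>R (\<Sum>j=1..n. (1 / sqrt (1 + (frob_norm (matrix_inv (P j)))\<^sup>2))
                    *\<^sub>R (Xbar ** (matrix_inv Xbar - matrix_inv (P j)) ** Xbar))"
proof -
  note m = assms(1) and X = assms(3) and P = assms(4) and mean = assms(5)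
    and cont = assms(7)
  define Y where "Y = matrix_inv Xbar"
  define a where "a = (\<Sum>i=1..m. tld_weight (X i)) / real m"
  define b where "b = (\<Sum>j=1..n. tld_weight (P j)) / real n"
  define c where "c \<epsilon> = \<epsilon> / ((1 - \<epsilon>) * a + \<epsilon> * b)" for \<epsilon>
  define D where "D = (1 / real n) *\<^sub>R (\<Sum>j=1..n. tld_weight (P j) *\<^sub>R (matrix_inv (P j) - Y))"
  define H where "H = - (1 / a) *\<^sub>R (Xbar ** D ** Xbar)"
  \<comment> \<open>Weights below \<open>1\<close> keep \<open>1 - \<epsilon>\<close> positive, so
    the denominator of \<open>c\<close> is positive with only \<open>b \<ge> 0\<close>.\<close>
  define \<epsilon>\<^sub>1 where "\<epsilon>\<^sub>1 = min \<epsilon>\<^sub>0 1"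
  have "a > 0"
    unfolding a_def using m by (intro divide_pos_pos sum_pos tld_weight_pos) auto
  have "b \<ge> 0"
    unfolding b_def by (intro divide_nonneg_nonneg sum_nonneg less_imp_le[OF tld_weight_pos]) auto
  have "\<epsilon>\<^sub>1 > 0"
    using assms(6) by (simp add: \<epsilon>\<^sub>1_def)
  have sumX: "(1 / real m) *\<^sub>R (\<Sum>i=1..m. tld_weight (X i) *\<^sub>R (matrix_inv (X i) - W))
      = (1 / real m) *\<^sub>R (\<Sum>i=1..m. tld_weight (X i) *\<^sub>R matrix_inv (X i)) - a *\<^sub>R W" for W
    unfolding sum_scaleR_diff by (simp add: a_def scaleR_diff_right)
  have mean': "is_contaminated_tbd_mean neg_log_det m X n P 0 Xbar"
    by (rule is_tbd_mean_iff_uncontaminated[THEN iffD1, OF mean])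
  have Xbar: "Xbar \<in> hpd"
    by (rule contaminated_mean_stationary(1)[OF X P mean'])
  then have inv: "invertible Xbar"
    by (rule hpd_invertible)
  \<comment> \<open>Stationarity of the uncontaminated mean evaluates \<open>sumX\<close> at
    \<open>W = Y\<close>, identifying its constant term as \<open>a Y\<close>.\<close>
  have "(1 / real m) *\<^sub>R (\<Sum>i=1..m. tld_weight (X i) *\<^sub>R (matrix_inv (X i) - Y)) = 0"
    using contaminated_mean_stationary(2)[OF X P mean'] by (simp add: Y_def)
  then have sumX': "(1 / real m) *\<^sub>R (\<Sum>i=1..m. tld_weight (X i) *\<^sub>R (matrix_inv (X i) - W))
      = a *\<^sub>R (Y - W)" for W
    unfolding sumX by (simp add: algebra_simps)
  \<comment> \<open>\<open>D\<close> is this sum at \<open>W = Y\<close>; replacing \<open>Y\<close>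
    by \<open>W\<close> adds \<open>b (Y - W)\<close>.\<close>
  have sumP: "(1 / real n) *\<^sub>R (\<Sum>j=1..n. tld_weight (P j) *\<^sub>R (matrix_inv (P j) - W))
      = D + b *\<^sub>R (Y - W)" for W
    unfolding D_def sum_scaleR_diff by (simp add: b_def scaleR_diff_right)
  have Xhat: "Xhat \<epsilon> \<in> hpd \<and> matrix_inv (Xhat \<epsilon>) = Y + c \<epsilon> *\<^sub>R D" if \<epsilon>: "0 \<le> \<epsilon>" "\<epsilon> < \<epsilon>\<^sub>1" for \<epsilon>
  proof -
    let ?W = "matrix_inv (Xhat \<epsilon>)" and ?d = "(1 - \<epsilon>) * a + \<epsilon> * b"
    have mean\<epsilon>: "is_contaminated_tbd_mean neg_log_det m X n P \<epsilon> (Xhat \<epsilon>)"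
      using cont \<epsilon> by (simp add: \<epsilon>\<^sub>1_def)
    have "?d > 0"
      using \<epsilon> \<open>a > 0\<close> \<open>b \<ge> 0\<close> by (intro add_pos_nonneg mult_pos_pos mult_nonneg_nonneg) (auto simp: \<epsilon>\<^sub>1_def)
    have "(1 - \<epsilon>) *\<^sub>R ((1 / real m) *\<^sub>R (\<Sum>i=1..m. tld_weight (X i) *\<^sub>R (matrix_inv (X i) - ?W)))
        + \<epsilon> *\<^sub>R ((1 / real n) *\<^sub>R (\<Sum>j=1..n. tld_weight (P j) *\<^sub>R (matrix_inv (P j) - ?W))) = 0"
      using contaminated_mean_stationary(2)[OF X P mean\<epsilon>] by simp
    \<comment> \<open>The data and outlier terms in \<open>Y - W\<close> combine with total weight
      \<open>?d\<close>, leaving \<open>\<epsilon> D\<close> as the only source.\<close>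
    then have "?d *\<^sub>R ?W = ?d *\<^sub>R Y + \<epsilon> *\<^sub>R D"
      unfolding sumX' sumP by (simp add: algebra_simps)
    also have "\<dots> = ?d *\<^sub>R (Y + c \<epsilon> *\<^sub>R D)"
      using \<open>?d > 0\<close> by (simp add: c_def scaleR_add_right)
    finally have "?W = Y + c \<epsilon> *\<^sub>R D"
      using \<open>?d > 0\<close> by (metis less_irrefl scaleR_cancel_left)
    then show ?thesis
      using contaminated_mean_stationary(1)[OF X P mean\<epsilon>] by blast
  qed
  note c_exp = contamination_ratio_expansion[OF \<open>a > 0\<close>, of b, folded c_def]
  have "\<forall>\<^sub>F \<epsilon> in at_right 0. \<epsilon> \<in> {0<..<\<epsilon>\<^sub>1}"
    using \<open>\<epsilon>\<^sub>1 > 0\<close> by (rule eventually_at_right_real)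
  then have "\<forall>\<^sub>F \<epsilon> in at_right 0. Xhat \<epsilon> ** (matrix_inv Xbar + c \<epsilon> *\<^sub>R D) = mat 1"
  proof eventually_elim
    case (elim \<epsilon>)
    then have "Xhat \<epsilon> \<in> hpd" "matrix_inv Xbar + c \<epsilon> *\<^sub>R D = matrix_inv (Xhat \<epsilon>)"
      using Xhat[of \<epsilon>] by (auto simp: Y_def)
    then show ?case
      using matrix_inv_mult(1) hpd_invertible by metis
  qed
  then have coeff: "is_first_order_coeff Xhat Xbar H"
    unfolding H_def by (rule first_order_coeff_of_inverse[OF inv _ c_exp(1)])
  then have infl: "influence_matrix Xhat Xbar = H"
    unfolding influence_matrix_def using first_order_coeff_unique by (intro the_equality) auto
  have YHY: "Y ** H ** Y = - ((1 / a) *\<^sub>R D)"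
  proof -
    have "Y ** (Xbar ** D ** Xbar) ** Y = (Y ** Xbar) ** D ** (Xbar ** Y)"
      by (simp add: matrix_mul_assoc)
    then show ?thesis
      using inv by (simp add: H_def Y_def matrix_inv_mult matrix_mult.scaleR_left
          matrix_mult.scaleR_right matrix_mult.minus_left matrix_mult.minus_right)
  qed
  \<comment> \<open>The gradient path is affine in the scalar \<open>c \<epsilon>\<close>, so its
    derivative follows from that of \<open>c\<close> alone.\<close>
  have "((\<lambda>\<epsilon>. - (Y + c \<epsilon> *\<^sub>R D)) has_vector_derivative Y ** H ** Y) (at 0 within {0..})"
    unfolding YHY
    by (auto intro!: derivative_eq_intros DERIV_subset[OF c_exp(2)])
  then have deriv: "((\<lambda>\<epsilon>. gradient neg_log_det (Xhat \<epsilon>)) has_vector_derivative Y ** H ** Y)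
      (at 0 within {0..})"
    using \<open>\<epsilon>\<^sub>1 > 0\<close>
  proof (rule has_vector_derivative_transform_within)
    \<comment> \<open>The agreement includes \<open>\<epsilon> = 0\<close>, since the hypothesis on
      \<open>Xhat\<close> covers weight zero.\<close>
    show "- (Y + c \<epsilon> *\<^sub>R D) = gradient neg_log_det (Xhat \<epsilon>)"
      if "\<epsilon> \<in> {0..}" "dist \<epsilon> 0 < \<epsilon>\<^sub>1" for \<epsilon>
      using Xhat[of \<epsilon>] that by (simp add: gradient_neg_log_det)
  qed simp
  have "Xbar ** D ** Xbar = - ((1 / real n) *\<^sub>R
      (\<Sum>j=1..n. tld_weight (P j) *\<^sub>R (Xbar ** (Y - matrix_inv (P j)) ** Xbar)))"
    by (simp add: D_def matrix_mult.scaleR_left matrix_mult.scaleR_right matrix_mult.sum_left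
        matrix_mult.sum_right matrix_mult.diff_left matrix_mult.diff_right
        sum_negf[symmetric] flip: scaleR_minus_right)
  \<comment> \<open>The two minus signs cancel, and \<open>1 / a\<close> together with the
    \<open>1 / n\<close> inside \<open>D\<close> produces the factor \<open>m / n\<close>.\<close>
  then have H: "H = (real m / real n * inverse (\<Sum>i=1..m. tld_weight (X i))) *\<^sub>R
      (\<Sum>j=1..n. tld_weight (P j) *\<^sub>R (Xbar ** (Y - matrix_inv (P j)) ** Xbar))"
    by (simp add: H_def a_def field_simps)
  show ?thesis
    using has_gradient_neg_log_det gradient_neg_log_det coeff deriv H
    by (auto simp: infl influence_function_def Y_def tld_weight_def)
qed

end
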